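(* Let $\alpha>0$, $\gamma>0$, let $\kappa$ be a fragmentation kernel (with total mass $N$) and let $\mu_0\in\mathcal M^+(\mathbb R^+)$ satisfy $\operatorname{supp}(\mu_0)\subset[0,L]$. Assume moreover that either $\gamma\ge1$ or $\operatorname{supp}(\mu_0)\subset[m,L]$ with $m>0$. Let $T>0$. Then the unique (non-negative) solution $\mu_t$ of the fragmentation equation with initial datum $\mu_0$ satisfies $$\|\mu_t\|_{BL}\le C\,\|\mu_0\|_{BL},\qquad 0\le t\le T,$$ where $C=C(L,N,T,\alpha,\gamma,m^{\gamma-1})$ is a constant depending (continuously) only on the listed parameters (the dependence on $m^{\gamma-1}$ being relevant only in the second case).
   Context: $\mathbb R^+=[0,\infty)$. $\mathcal M(\mathbb R^+)$ is the space of signed Radon measures supported in $\mathbb R^+$, endowed with the total variation norm $\|\cdot\|_{TV}$, for which it is a Banach space (so its elements are finite measures); $\mathcal M^+(\mathbb R^+)$ is the subset of non-negative measures. The Bounded-Lipschitz norm is $\|\mu\|_{BL}=\sup\{\int_{\mathbb R^+}\varphi\,d\mu:\ \varphi\in\mathcal C(\mathbb R^+)\cap L^1(d|\mu|),\ \|\varphi\|_\infty\le1,\ \|\varphi'\|_\infty\le1\}$. Fragmentation kernel: $\kappa\in\mathcal M^+(\mathbb R^+)$ with no atom at $0$ nor at $1$, $\operatorname{supp}(\kappa)\subset[0,1]$, $\int_0^1 d\kappa(z)=N<+\infty$, $\int_0^1 z\,d\kappa(z)=1$. Fragmentation equation (formally): $\partial_t\mu_t(x)=-\alpha x^\gamma\mu_t(x)+\alpha\int_x^\infty\kappa(x/y)\,y^{\gamma-1}d\mu_t(y)$,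 $\mu_{t=0}=\mu_0$. A measure-valued solution is a family $(\mu_t)_{t\ge0}\subset\mathcal M(\mathbb R^+)$ such that $t\mapsto\mu_t$ is narrowly continuous and, for all $\varphi\in\mathcal C(\mathbb R^+)$ such that $x\mapsto\varphi(x)/(1+x)$ is bounded on $[0,\infty)$ and all $t\ge0$, $$\int_{\mathbb R^+}\varphi\,d\mu_t=\int_{\mathbb R^+}\varphi\,d\mu_0+\int_0^t ds\int_{\mathbb R^+}d\mu_s(x)\,\alpha x^\gamma\Big(-\varphi(x)+\int_0^1 d\kappa(z)\varphi(xz)\Big).$$ For compactly supported $\mu_0\in\mathcal M^+(\mathbb R^+)$ there is a unique non-negative such solution in $\mathcal C(\mathbb R^+,(\mathcal M(\mathbb R^+),\|\cdot\|_{TV}))$; it is the solution meant in the claim. *)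

theory Defs
  imports "HOL-Analysis.Analysis"
begin

definition msupp :: "real measure \<Rightarrow> real set" where
  "msupp M = {x. \<forall>U. open U \<longrightarrow> x \<in> U \<longrightarrow> emeasure M U > 0}"

text \<open>The cone of non-negative Radon measures on \<^term>\<open>{0..} :: real set\<close> with finite total
  variation, realised as finite Borel measures on the line with support in the half-line
  (every finite Borel measure on the line is Radon).\<close>

definition nonneg_radon :: "real measure \<Rightarrow> bool" where
  "nonneg_radon M \<longleftrightarrow> finite_measure M \<and> sets M = sets borel \<and> msupp M \<subseteq> {0..}"

text \<open>The condition \<open>\<parallel>\<phi>'\<parallel>\<^sub>\<infinity> \<le> 1\<close> refers to the weak derivative, i.e. it says that
  \<open>\<phi>\<close> is Lipschitz with constant 1. (An almost everywhere bound on the classical derivative would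
  also admit Cantor-type functions.) The norm is stated on non-negative measures, where
  \<open>|M| = M\<close>.\<close>

definition BL_norm :: "real measure \<Rightarrow> real" where
  "BL_norm M = Sup {LINT x:{0..}|M. \<phi> x | \<phi> :: real \<Rightarrow> real.
      continuous_on {0..} \<phi> \<and> set_integrable M {0..} \<phi> \<and>
      (\<forall>x\<ge>0. \<bar>\<phi> x\<bar> \<le> 1) \<and> 1-lipschitz_on {0..} \<phi>}"

text \<open>A finite signed Borel measure is represented here by its set function.\<close>

definition TV_norm :: "(real set \<Rightarrow> real) \<Rightarrow> real" where
  "TV_norm \<nu> = Sup {\<Sum>A\<in>P. \<bar>\<nu> A\<bar> | P. finite P \<and> P \<subseteq> sets borel \<and> disjoint P}"

definition TV_continuous :: "(real \<Rightarrow> real measure) \<Rightarrow> bool" where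
  "TV_continuous \<mu> \<longleftrightarrow> (\<forall>s\<ge>0.
      ((\<lambda>t. TV_norm (\<lambda>A. measure (\<mu> t) A - measure (\<mu> s) A)) \<longlongrightarrow> 0) (at s within {0..}))"

definition narrowly_continuous :: "(real \<Rightarrow> real measure) \<Rightarrow> bool" where
  "narrowly_continuous \<mu> \<longleftrightarrow> (\<forall>\<phi> :: real \<Rightarrow> real.
      continuous_on {0..} \<phi> \<longrightarrow> bounded (\<phi> ` {0..}) \<longrightarrow>
      continuous_on {0..} (\<lambda>t. LINT x:{0..}|\<mu> t. \<phi> x))"

definition fragmentation_kernel :: "real measure \<Rightarrow> real \<Rightarrow> bool" where
  "fragmentation_kernel \<kappa> N \<longleftrightarrow>
      nonneg_radon \<kappa> \<and> msupp \<kappa> \<subseteq> {0..1} \<and> measure \<kappa> {0} = 0 \<and> measure \<kappa> {1} = 0 \<and>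
      (LINT z:{0..1}|\<kappa>. 1) = N \<and> (LINT z:{0..1}|\<kappa>. z) = 1"

definition frag_integrand ::
    "real \<Rightarrow> real \<Rightarrow> real measure \<Rightarrow> (real \<Rightarrow> real) \<Rightarrow> real \<Rightarrow> real" where
  "frag_integrand \<alpha> \<gamma> \<kappa> \<phi> x = \<alpha> * x powr \<gamma> * (- \<phi> x + (LINT z:{0..1}|\<kappa>. \<phi> (x * z)))"

text \<open>The integrability clauses say that the integrals in the weak formulation exist; they have to
  be stated because the Bochner integral of a non-integrable function is 0.\<close>

definition nonneg_frag_solution ::
    "real \<Rightarrow> real \<Rightarrow> real measure \<Rightarrow> real measure \<Rightarrow> (real \<Rightarrow> real measure) \<Rightarrow> bool" where
  "nonneg_frag_solution \<alpha> \<gamma> \<kappa> \<mu>0 \<mu> \<longleftrightarrow>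
      (\<forall>t\<ge>0. nonneg_radon (\<mu> t)) \<and> \<mu> 0 = \<mu>0 \<and> narrowly_continuous \<mu> \<and>
      (\<forall>\<phi>. continuous_on {0..} \<phi> \<longrightarrow> bounded ((\<lambda>x. \<phi> x / (1 + x)) ` {0..}) \<longrightarrow>
        (\<forall>t\<ge>0.
          set_integrable (\<mu> t) {0..} \<phi> \<and>
          set_integrable (\<mu> t) {0..} (frag_integrand \<alpha> \<gamma> \<kappa> \<phi>) \<and>
          set_integrable lborel {0..t} (\<lambda>s. LINT x:{0..}|\<mu> s. frag_integrand \<alpha> \<gamma> \<kappa> \<phi> x) \<and>
          (LINT x:{0..}|\<mu> t. \<phi> x) =
            (LINT x:{0..}|\<mu>0. \<phi> x) +
            (LINT s:{0..t}|lborel. (LINT x:{0..}|\<mu> s. frag_integrand \<alpha> \<gamma> \<kappa> \<phi> x))))"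

end

theory Submission
  imports Defs
begin

text \<open>On non-negative measures the supremum defining the Bounded-Lipschitz norm is attained at the
  constant function 1, so that \<open>\<parallel>\<mu>\<parallel>\<^sub>B\<^sub>L\<close> is the total mass of \<open>\<mu>\<close>
  (\<open>BL_norm_eq_mass\<close>). The theorem is therefore a bound on the growth of the total mass, that is,
  of the number of fragments.

  The support of the solution stays in \<open>[0, L]\<close>, because fragmentation only produces smaller
  particles. To see this without solving the equation, take the test function
  \<open>\<phi>(x) = max 0 (x - L)\<close> (\<open>frag_solution_support\<close>): from \<open>\<phi>(x z) \<le> z \<phi>(x)\<close> and
  \<open>\<integral> z d\<kappa>(z) = 1\<close> the right-hand side of the equation is non-positive, so
  \<open>\<integral> \<phi> d\<mu>\<^sub>t\<close> stays 0.

  With the test function 1 the fragmentation rate enters through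
  \<open>\<alpha> (N - 1) x\<^sup>\<gamma> \<le> \<alpha> (N - 1) L\<^sup>\<gamma>\<close> only, where \<open>N \<ge> 1\<close> by conservation of mass.
  Gronwall's inequality (\<open>gronwall_integral\<close>) then gives
  \<open>\<parallel>\<mu>\<^sub>t\<parallel>\<^sub>B\<^sub>L \<le> exp (\<alpha> (N - 1) L\<^sup>\<gamma> t) \<parallel>\<mu>\<^sub>0\<parallel>\<^sub>B\<^sub>L\<close>, and replacing \<open>t\<close> by \<open>T\<close> yields a
  constant that serves in both cases of the theorem.\<close>

text \<open>The complement of the support is a union of open null sets; by the Lindelof property of the
  line countably many of them suffice.\<close>

lemma AE_in_msupp:
  assumes M: "sets M = sets borel"
  shows "AE x in M. x \<in> msupp M"
proof -
  define F where "F = {U :: real set. open U \<and> emeasure M U = 0}"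
  have compl: "- msupp M = \<Union>F"
    unfolding msupp_def F_def by (auto simp: not_gr_zero)
  have "\<And>U. U \<in> F \<Longrightarrow> open U"
    unfolding F_def by blast
  then obtain F' where F': "F' \<subseteq> F" "countable F'" "\<Union>F' = \<Union>F"
    using Lindelof by metis
  have "(\<Union>U\<in>F'. U) \<in> null_sets M"
  proof (rule null_sets_UN'[OF F'(2)])
    fix U assume "U \<in> F'"
    then show "U \<in> null_sets M"
      using F'(1) M unfolding F_def by (auto simp: null_sets_def)
  qed
  then have "- msupp M \<in> null_sets M"
    using compl F'(3) by simp
  then show ?thesis
    using AE_not_in by fastforce
qed

lemma set_lebesgue_integral_nonneg:
  fixes f :: "'a \<Rightarrow> real"
  assumes "\<And>x. x \<in> A \<Longrightarrow> 0 \<le> f x"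
  shows "0 \<le> (LINT x:A|M. f x)"
  using assms unfolding set_lebesgue_integral_def
  by (intro Bochner_Integration.integral_nonneg) (simp add: indicator_def)

lemma set_lebesgue_integral_nonpos:
  fixes f :: "'a \<Rightarrow> real"
  assumes "\<And>x. x \<in> A \<Longrightarrow> f x \<le> 0"
  shows "(LINT x:A|M. f x) \<le> 0"
  using set_lebesgue_integral_nonneg[of A "\<lambda>x. - f x" M] assms
  by (simp add: set_lebesgue_integral_def)

lemma BL_norm_eq_mass:
  assumes "nonneg_radon M"
  shows "BL_norm M = (LINT x:{0..}|M. 1)"
  unfolding BL_norm_def
proof (rule cSup_eq_maximum)
  interpret finite_measure M
    using assms by (simp add: nonneg_radon_def)
  have "{0..} \<in> sets M"
    using assms by (simp add: nonneg_radon_def)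
  then have one: "set_integrable M {0..} (\<lambda>x. 1 :: real)"
    unfolding set_integrable_def by (simp add: emeasure_eq_measure)
  show "(LINT x:{0..}|M. 1) \<in> {LINT x:{0..}|M. \<phi> x | \<phi> :: real \<Rightarrow> real.
      continuous_on {0..} \<phi> \<and> set_integrable M {0..} \<phi> \<and>
      (\<forall>x\<ge>0. \<bar>\<phi> x\<bar> \<le> 1) \<and> 1-lipschitz_on {0..} \<phi>}"
    using one by (auto intro!: exI[of _ "\<lambda>x. 1"] simp: lipschitz_on_def)
  fix y assume "y \<in> {LINT x:{0..}|M. \<phi> x | \<phi> :: real \<Rightarrow> real.
      continuous_on {0..} \<phi> \<and> set_integrable M {0..} \<phi> \<and>
      (\<forall>x\<ge>0. \<bar>\<phi> x\<bar> \<le> 1) \<and> 1-lipschitz_on {0..} \<phi>}"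
  then obtain \<phi> :: "real \<Rightarrow> real" where \<phi>: "y = (LINT x:{0..}|M. \<phi> x)"
      "set_integrable M {0..} \<phi>" "\<forall>x\<ge>0. \<bar>\<phi> x\<bar> \<le> 1"
    by blast
  show "y \<le> (LINT x:{0..}|M. 1)"
    unfolding \<phi>(1) by (rule set_integral_mono[OF \<phi>(2) one]) (use \<phi>(3) in force)
qed

text \<open>The function \<open>(a + b \<integral>\<^sub>0\<^sup>t f) exp (- b t)\<close> has a non-positive derivative.\<close>

lemma gronwall_integral:
  fixes f :: "real \<Rightarrow> real"
  assumes "0 \<le> T" and f: "continuous_on {0..T} f" and "0 \<le> b"
    and bound: "\<And>t. t \<in> {0..T} \<Longrightarrow> f t \<le> a + b * integral {0..t} f"
  shows "f T \<le> a * exp (b * T)"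
proof -
  define H where "H t = (a + b * integral {0..t} f) * exp (- (b * t))" for t
  have "H T \<le> H 0"
  proof (rule DERIV_nonpos_imp_decreasing_open[OF \<open>0 \<le> T\<close>])
    fix t assume t: "0 < t" "t < T"
    have I: "((\<lambda>t. integral {0..t} f) has_real_derivative f t) (at t)"
      using integral_has_real_derivative[OF f, of t] t at_within_Icc_at[of 0 t T] by simp
    have "(H has_real_derivative
        (f t - (a + b * integral {0..t} f)) * b * exp (- (b * t))) (at t)"
      unfolding H_def by (rule derivative_eq_intros I refl | simp add: algebra_simps)+
    moreover have "(f t - (a + b * integral {0..t} f)) * b * exp (- (b * t)) \<le> 0"
      using bound[of t] t \<open>0 \<le> b\<close> by (intro mult_nonpos_nonneg) auto
    ultimately show "\<exists>y. (H has_real_derivative y) (at t) \<and> y \<le> 0"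
      by blast
  next
    show "continuous_on {0..T} H"
      unfolding H_def using integrable_continuous_real[OF f]
      by (intro continuous_intros indefinite_integral_continuous_1)
  qed
  then have "(a + b * integral {0..T} f) * exp (- (b * T)) \<le> a"
    by (simp add: H_def)
  then have "a + b * integral {0..T} f \<le> a * exp (b * T)"
    by (simp add: exp_minus field_simps)
  with bound[of T] \<open>0 \<le> T\<close> show ?thesis
    by simp
qed

lemma fragmentation_kernel_integrable:
  assumes "fragmentation_kernel \<kappa> N" and "continuous_on {0..1} g"
  shows "set_integrable \<kappa> {0..1} (g :: real \<Rightarrow> real)"
proof -
  interpret finite_measure \<kappa>
    using assms by (simp add: fragmentation_kernel_def nonneg_radon_def)
  have s: "sets \<kappa> = sets borel"
    using assms by (simp add: fragmentation_kernel_def nonneg_radon_def)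
  have "(\<lambda>z. indicator {0..1} z *\<^sub>R g z) \<in> borel_measurable \<kappa>"
    unfolding measurable_cong_sets[OF s refl]
    by (rule borel_measurable_continuous_on_indicator[OF _ assms(2)]) simp
  moreover have "bounded (g ` {0..1})"
    using assms(2) by (intro compact_imp_bounded compact_continuous_image) auto
  then obtain B where "\<forall>z\<in>{0..1}. \<bar>g z\<bar> \<le> B"
    by (auto simp: bounded_iff)
  then have "AE z in \<kappa>. norm (indicator {0..1} z *\<^sub>R g z) \<le> \<bar>B\<bar>"
    by (intro AE_I2) (force simp: indicator_def)
  ultimately show ?thesis
    unfolding set_integrable_def by (metis integrable_const_bound)
qed

text \<open>A particle breaks into at least one fragment: \<open>1 = \<integral> z d\<kappa> \<le> \<integral> 1 d\<kappa>\<close>.\<close>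

lemma fragmentation_kernel_mass_ge_1:
  assumes "fragmentation_kernel \<kappa> N"
  shows "1 \<le> N"
proof -
  have "(LINT z:{0..1}|\<kappa>. z) \<le> (LINT z:{0..1}|\<kappa>. 1)"
    by (rule set_integral_mono)
      (use fragmentation_kernel_integrable[OF assms] in auto)
  then show ?thesis
    using assms by (simp add: fragmentation_kernel_def)
qed

text \<open>Integrating \<open>\<phi> (x z) \<le> z \<phi> x\<close> against \<open>\<kappa>\<close>, whose first moment is 1, gives the sign. Convex
  functions vanishing at 0 satisfy this inequality; their integrals do not increase along
  the dynamics.\<close>

lemma frag_integrand_nonpos:
  assumes \<kappa>: "fragmentation_kernel \<kappa> N" and "0 \<le> \<alpha>" "0 \<le> x"
    and \<phi>: "continuous_on {0..} \<phi>" "\<And>z. 0 \<le> z \<Longrightarrow> z \<le> 1 \<Longrightarrow> \<phi> (x * z) \<le> z * \<phi> x"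
  shows "frag_integrand \<alpha> \<gamma> \<kappa> \<phi> x \<le> 0"
proof -
  have "continuous_on {0..1} (\<lambda>z. \<phi> (x * z))"
    using \<open>0 \<le> x\<close> by (intro continuous_on_compose2[OF \<phi>(1)] continuous_intros) auto
  then have "(LINT z:{0..1}|\<kappa>. \<phi> (x * z)) \<le> (LINT z:{0..1}|\<kappa>. z * \<phi> x)"
    by (intro set_integral_mono fragmentation_kernel_integrable[OF \<kappa>] continuous_intros)
      (use \<phi>(2) in auto)
  also have "\<dots> = \<phi> x"
    using \<kappa> by (simp add: fragmentation_kernel_def)
  finally show ?thesis
    using \<open>0 \<le> \<alpha>\<close> unfolding frag_integrand_def by (intro mult_nonneg_nonpos) auto
qed

lemma frag_solution_support:
  assumes \<kappa>: "fragmentation_kernel \<kappa> N" and "0 \<le> \<alpha>" "0 \<le> L"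
    and \<mu>0: "nonneg_radon \<mu>0" "msupp \<mu>0 \<subseteq> {0..L}"
    and sol: "nonneg_frag_solution \<alpha> \<gamma> \<kappa> \<mu>0 \<mu>" and "0 \<le> t"
  shows "AE x in \<mu> t. 0 \<le> x \<longrightarrow> x \<le> L"
proof -
  define \<phi> where "\<phi> x = max 0 (x - L)" for x :: real
  have cont: "continuous_on A \<phi>" for A
    unfolding \<phi>_def by (intro continuous_intros)
  have "norm (\<phi> x / (1 + x)) \<le> 1" if "0 \<le> x" for x
    using that \<open>0 \<le> L\<close> by (auto simp: \<phi>_def max_def)
  then have "bounded ((\<lambda>x. \<phi> x / (1 + x)) ` {0..})"
    unfolding bounded_iff by (intro exI[of _ 1]) auto
  then have int: "set_integrable (\<mu> t) {0..} \<phi>"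
    and eq: "(LINT x:{0..}|\<mu> t. \<phi> x) = (LINT x:{0..}|\<mu>0. \<phi> x) +
        (LINT s:{0..t}|lborel. (LINT x:{0..}|\<mu> s. frag_integrand \<alpha> \<gamma> \<kappa> \<phi> x))"
    using sol cont \<open>0 \<le> t\<close> unfolding nonneg_frag_solution_def by blast+
  have "\<phi> (x * z) \<le> z * \<phi> x" if "0 \<le> x" "0 \<le> z" "z \<le> 1" for x z
  proof -
    have "L * z \<le> L"
      using that \<open>0 \<le> L\<close> by (simp add: mult_left_le)
    moreover have "z * (x - L) \<le> z * \<phi> x" "0 \<le> z * \<phi> x"
      using that by (auto simp: \<phi>_def intro: mult_left_mono)
    ultimately show ?thesis
      by (simp add: \<phi>_def algebra_simps)
  qed
  then have "frag_integrand \<alpha> \<gamma> \<kappa> \<phi> x \<le> 0" if "0 \<le> x" for x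
    using frag_integrand_nonpos[OF \<kappa> \<open>0 \<le> \<alpha>\<close> that cont] that by blast
  then have "(LINT s:{0..t}|lborel. (LINT x:{0..}|\<mu> s. frag_integrand \<alpha> \<gamma> \<kappa> \<phi> x)) \<le> 0"
    by (intro set_lebesgue_integral_nonpos) auto
  moreover have "(LINT x:{0..}|\<mu>0. \<phi> x) = 0"
  proof -
    have "AE x in \<mu>0. x \<in> {0..L}"
      using AE_in_msupp \<mu>0 unfolding nonneg_radon_def
      by (metis (no_types, lifting) AE_mp AE_I2 subsetD)
    then have "AE x in \<mu>0. indicator {0..} x *\<^sub>R \<phi> x = 0"
      by eventually_elim (auto simp: \<phi>_def)
    then show ?thesis
      unfolding set_lebesgue_integral_def by (rule integral_eq_zero_AE)
  qed
  moreover have "0 \<le> (LINT x:{0..}|\<mu> t. \<phi> x)"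
    by (rule set_lebesgue_integral_nonneg) (simp add: \<phi>_def)
  ultimately have "(\<integral>x. indicator {0..} x *\<^sub>R \<phi> x \<partial>\<mu> t) = 0"
    using eq by (simp add: set_lebesgue_integral_def)
  moreover have "AE x in \<mu> t. 0 \<le> indicator {0..} x *\<^sub>R \<phi> x"
    by (simp add: \<phi>_def)
  ultimately have "AE x in \<mu> t. indicator {0..} x *\<^sub>R \<phi> x = 0"
    using integral_nonneg_eq_0_iff_AE int unfolding set_integrable_def by blast
  then show ?thesis
    by eventually_elim (auto simp: \<phi>_def max_def split: if_splits)
qed

lemma frag_solution_BL_bound:
  assumes \<kappa>: "fragmentation_kernel \<kappa> N" and "0 \<le> \<alpha>" "0 \<le> \<gamma>" "0 \<le> L"
    and \<mu>0: "nonneg_radon \<mu>0" "msupp \<mu>0 \<subseteq> {0..L}"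
    and sol: "nonneg_frag_solution \<alpha> \<gamma> \<kappa> \<mu>0 \<mu>" and "0 \<le> t"
  shows "BL_norm (\<mu> t) \<le> exp (\<alpha> * (N - 1) * L powr \<gamma> * t) * BL_norm \<mu>0"
proof -
  define m where "m s = (LINT x:{0..}|\<mu> s. 1 :: real)" for s
  define b where "b = \<alpha> * (N - 1) * L powr \<gamma>"
  have N: "1 \<le> N"
    using fragmentation_kernel_mass_ge_1[OF \<kappa>] .
  have b0: "0 \<le> b"
    using N \<open>0 \<le> \<alpha>\<close> by (simp add: b_def)
  have m_cont: "continuous_on {0..t} m" for t
  proof -
    have "bounded ((\<lambda>_ :: real. 1 :: real) ` {0..})"
      unfolding bounded_iff by auto
    then have "continuous_on {0..} m"
      using sol continuous_on_const[of "{0..}" "1 :: real"]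
      unfolding nonneg_frag_solution_def narrowly_continuous_def m_def by blast
    then show ?thesis
      by (rule continuous_on_subset) auto
  qed
  have "norm (1 / (1 + x)) \<le> 1" if "0 \<le> x" for x :: real
    using that by simp
  then have bdd: "bounded ((\<lambda>x :: real. 1 / (1 + x)) ` {0..})"
    unfolding bounded_iff by (intro exI[of _ 1]) auto
  define F where "F s = (LINT x:{0..}|\<mu> s. frag_integrand \<alpha> \<gamma> \<kappa> (\<lambda>_. 1) x)" for s
  have weak: "set_integrable (\<mu> s) {0..} (\<lambda>_. 1 :: real)"
    "set_integrable (\<mu> s) {0..} (frag_integrand \<alpha> \<gamma> \<kappa> (\<lambda>_. 1))"
    "set_integrable lborel {0..s} F" "m s = m 0 + (LINT r:{0..s}|lborel. F r)" if "0 \<le> s" for s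
    using sol that bdd unfolding nonneg_frag_solution_def F_def m_def by auto
  have F_le: "F s \<le> b * m s" if "0 \<le> s" for s
  proof -
    have "F s \<le> (LINT x:{0..}|\<mu> s. b * 1)"
      unfolding F_def
    proof (rule set_integral_mono_AE)
      show "AE x\<in>{0..} in \<mu> s. frag_integrand \<alpha> \<gamma> \<kappa> (\<lambda>_. 1) x \<le> b * 1"
        using frag_solution_support[OF \<kappa> \<open>0 \<le> \<alpha>\<close> \<open>0 \<le> L\<close> \<mu>0 sol that]
      proof eventually_elim
        case (elim x)
        show ?case
        proof
          assume "x \<in> {0..}"
          then have "x powr \<gamma> \<le> L powr \<gamma>"
            using elim \<open>0 \<le> \<gamma>\<close> by (intro powr_mono2) auto
          then have "\<alpha> * (N - 1) * x powr \<gamma> \<le> b"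
            using N \<open>0 \<le> \<alpha>\<close> unfolding b_def by (intro mult_left_mono) auto
          moreover have "(LINT z:{0..1}|\<kappa>. 1) = N"
            using \<kappa> by (simp add: fragmentation_kernel_def)
          ultimately show "frag_integrand \<alpha> \<gamma> \<kappa> (\<lambda>_. 1) x \<le> b * 1"
            by (simp add: frag_integrand_def algebra_simps)
        qed
      qed
    qed (intro weak[OF that] set_integrable_mult_right)+
    also have "\<dots> = b * m s"
      unfolding m_def by (rule set_integral_mult_right)
    finally show ?thesis .
  qed
  have "m t \<le> m 0 * exp (b * t)"
  proof (rule gronwall_integral[OF \<open>0 \<le> t\<close> m_cont b0])
    fix s assume s: "s \<in> {0..t}"
    have m_int: "set_integrable lborel {0..s} m"
      by (rule borel_integrable_atLeastAtMost'[OF m_cont])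
    have "(LINT r:{0..s}|lborel. F r) \<le> (LINT r:{0..s}|lborel. b * m r)"
      using s by (intro set_integral_mono weak set_integrable_mult_right m_int F_le) auto
    also have "\<dots> = b * integral {0..s} m"
      using set_borel_integral_eq_integral(2)[OF m_int] by simp
    finally show "m s \<le> m 0 + b * integral {0..s} m"
      using weak(4)[of s] s by simp
  qed
  moreover have "BL_norm (\<mu> s) = m s" if "0 \<le> s" for s
    using BL_norm_eq_mass[of "\<mu> s"] sol that by (simp add: nonneg_frag_solution_def m_def)
  moreover have "\<mu> 0 = \<mu>0"
    using sol by (simp add: nonneg_frag_solution_def)
  ultimately show ?thesis
    using \<open>0 \<le> t\<close> by (metis b_def mult.commute order_refl)
qed

lemma frag_solution_BL_bound_uniform:
  assumes \<kappa>: "fragmentation_kernel \<kappa> N" and "0 \<le> \<alpha>" "0 \<le> \<gamma>" "0 \<le> L"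
    and \<mu>0: "nonneg_radon \<mu>0" "msupp \<mu>0 \<subseteq> {0..L}"
    and sol: "nonneg_frag_solution \<alpha> \<gamma> \<kappa> \<mu>0 \<mu>" and t: "t \<in> {0..T}"
  shows "BL_norm (\<mu> t) \<le> exp (\<alpha> * (N - 1) * L powr \<gamma> * T) * BL_norm \<mu>0"
proof -
  have "0 \<le> \<alpha> * (N - 1) * L powr \<gamma>"
    using fragmentation_kernel_mass_ge_1[OF \<kappa>] \<open>0 \<le> \<alpha>\<close> by simp
  then have "exp (\<alpha> * (N - 1) * L powr \<gamma> * t) \<le> exp (\<alpha> * (N - 1) * L powr \<gamma> * T)"
    using t by (simp add: mult_left_mono)
  moreover have "0 \<le> BL_norm \<mu>0"
    unfolding BL_norm_eq_mass[OF \<mu>0(1)] by (rule set_lebesgue_integral_nonneg) simp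
  ultimately show ?thesis
    using frag_solution_BL_bound[OF assms(1-7), of t] t
    by (meson atLeastAtMost_iff mult_right_mono order_trans)
qed

theorem theorem4:
  shows "(\<exists>C :: real \<times> real \<times> real \<times> real \<times> real \<Rightarrow> real.
            continuous_on ({0..} \<times> {0<..} \<times> {0<..} \<times> {0<..} \<times> {0<..}) C \<and>
            (\<forall>L N T \<alpha> \<gamma> \<kappa> \<mu>0 \<mu>.
               L \<ge> 0 \<longrightarrow> T > 0 \<longrightarrow> \<alpha> > 0 \<longrightarrow> \<gamma> > 0 \<longrightarrow> fragmentation_kernel \<kappa> N \<longrightarrow>
               nonneg_radon \<mu>0 \<longrightarrow> msupp \<mu>0 \<subseteq> {0..L} \<longrightarrow> \<gamma> \<ge> 1 \<longrightarrow>
               nonneg_frag_solution \<alpha> \<gamma> \<kappa> \<mu>0 \<mu> \<longrightarrow> TV_continuous \<mu> \<longrightarrow>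
               (\<forall>t\<in>{0..T}. BL_norm (\<mu> t) \<le> C (L, N, T, \<alpha>, \<gamma>) * BL_norm \<mu>0))) \<and>
         (\<exists>C :: real \<times> real \<times> real \<times> real \<times> real \<times> real \<Rightarrow> real.
            continuous_on ({0..} \<times> {0<..} \<times> {0<..} \<times> {0<..} \<times> {0<..} \<times> {0<..}) C \<and>
            (\<forall>L N T \<alpha> \<gamma> m \<kappa> \<mu>0 \<mu>.
               L \<ge> 0 \<longrightarrow> T > 0 \<longrightarrow> \<alpha> > 0 \<longrightarrow> \<gamma> > 0 \<longrightarrow> fragmentation_kernel \<kappa> N \<longrightarrow>
               nonneg_radon \<mu>0 \<longrightarrow> m > 0 \<longrightarrow> msupp \<mu>0 \<subseteq> {m..L} \<longrightarrow>
               nonneg_frag_solution \<alpha> \<gamma> \<kappa> \<mu>0 \<mu> \<longrightarrow> TV_continuous \<mu> \<longrightarrow>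
               (\<forall>t\<in>{0..T}. BL_norm (\<mu> t)
                  \<le> C (L, N, T, \<alpha>, \<gamma>, m powr (\<gamma> - 1)) * BL_norm \<mu>0)))"
proof (intro conjI)
  let ?C = "\<lambda>(L, N, T, \<alpha>, \<gamma>). exp (\<alpha> * (N - 1) * L powr \<gamma> * T) :: real"
  have "continuous_on ({0..} \<times> {0<..} \<times> {0<..} \<times> {0<..} \<times> {0<..}) ?C"
    unfolding case_prod_beta by (intro continuous_intros continuous_on_powr') auto
  moreover have "BL_norm (\<mu> t) \<le> ?C (L, N, T, \<alpha>, \<gamma>) * BL_norm \<mu>0"
    if "L \<ge> 0" "\<alpha> > 0" "\<gamma> > 0" "fragmentation_kernel \<kappa> N" "nonneg_radon \<mu>0"
      "msupp \<mu>0 \<subseteq> {0..L}" "nonneg_frag_solution \<alpha> \<gamma> \<kappa> \<mu>0 \<mu>" "t \<in> {0..T}"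
    for L N T \<alpha> \<gamma> \<kappa> \<mu>0 \<mu> t
    using frag_solution_BL_bound_uniform[OF that(4) _ _ that(1,5-8)] that(2,3) by simp
  ultimately show "\<exists>C :: real \<times> real \<times> real \<times> real \<times> real \<Rightarrow> real.
      continuous_on ({0..} \<times> {0<..} \<times> {0<..} \<times> {0<..} \<times> {0<..}) C \<and>
      (\<forall>L N T \<alpha> \<gamma> \<kappa> \<mu>0 \<mu>.
         L \<ge> 0 \<longrightarrow> T > 0 \<longrightarrow> \<alpha> > 0 \<longrightarrow> \<gamma> > 0 \<longrightarrow> fragmentation_kernel \<kappa> N \<longrightarrow>
         nonneg_radon \<mu>0 \<longrightarrow> msupp \<mu>0 \<subseteq> {0..L} \<longrightarrow> \<gamma> \<ge> 1 \<longrightarrow>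
         nonneg_frag_solution \<alpha> \<gamma> \<kappa> \<mu>0 \<mu> \<longrightarrow> TV_continuous \<mu> \<longrightarrow>
         (\<forall>t\<in>{0..T}. BL_norm (\<mu> t) \<le> C (L, N, T, \<alpha>, \<gamma>) * BL_norm \<mu>0))"
    by (intro exI[of _ ?C]) blast
next
  let ?C = "\<lambda>(L, N, T, \<alpha>, \<gamma>, p). exp (\<alpha> * (N - 1) * L powr \<gamma> * T) :: real"
  have "continuous_on ({0..} \<times> {0<..} \<times> {0<..} \<times> {0<..} \<times> {0<..} \<times> {0<..}) ?C"
    unfolding case_prod_beta by (intro continuous_intros continuous_on_powr') auto
  moreover have "BL_norm (\<mu> t) \<le> ?C (L, N, T, \<alpha>, \<gamma>, m powr (\<gamma> - 1)) * BL_norm \<mu>0"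
    if "L \<ge> 0" "\<alpha> > 0" "\<gamma> > 0" "fragmentation_kernel \<kappa> N" "nonneg_radon \<mu>0" "m > 0"
      "msupp \<mu>0 \<subseteq> {m..L}" "nonneg_frag_solution \<alpha> \<gamma> \<kappa> \<mu>0 \<mu>" "t \<in> {0..T}"
    for L N T \<alpha> \<gamma> m \<kappa> \<mu>0 \<mu> t
  proof -
    have "msupp \<mu>0 \<subseteq> {0..L}"
      using that(6,7) by force
    then show ?thesis
      using frag_solution_BL_bound_uniform[OF that(4) _ _ that(1,5) _ that(8,9)] that(2,3) by simp
  qed
  ultimately show "\<exists>C :: real \<times> real \<times> real \<times> real \<times> real \<times> real \<Rightarrow> real.
      continuous_on ({0..} \<times> {0<..} \<times> {0<..} \<times> {0<..} \<times> {0<..} \<times> {0<..}) C \<and>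
      (\<forall>L N T \<alpha> \<gamma> m \<kappa> \<mu>0 \<mu>.
         L \<ge> 0 \<longrightarrow> T > 0 \<longrightarrow> \<alpha> > 0 \<longrightarrow> \<gamma> > 0 \<longrightarrow> fragmentation_kernel \<kappa> N \<longrightarrow>
         nonneg_radon \<mu>0 \<longrightarrow> m > 0 \<longrightarrow> msupp \<mu>0 \<subseteq> {m..L} \<longrightarrow>
         nonneg_frag_solution \<alpha> \<gamma> \<kappa> \<mu>0 \<mu> \<longrightarrow> TV_continuous \<mu> \<longrightarrow>
         (\<forall>t\<in>{0..T}. BL_norm (\<mu> t)
            \<le> C (L, N, T, \<alpha>, \<gamma>, m powr (\<gamma> - 1)) * BL_norm \<mu>0))"
    by (intro exI[of _ ?C]) blast
qed

end
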